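(* For every $B\in\mathbb{P}(2n)$ there exist distinct positive numbers $\mu_1,\dots,\mu_m$ and symplectic projections $P_1,\dots,P_m$ on $\mathbb{R}^{2n}$ that satisfy: (i) $P_jJP_k=0$ for all $j\ne k$, $j,k=1,\dots,m$; (ii) $\sum_{k=1}^{m}P_kJP_k=J$; (iii) $B=\sum_{k=1}^{m}\mu_kP_k$. The numbers $\mu_1,\dots,\mu_m$ and the symplectic projections $P_1,\dots,P_m$ are uniquely determined by the conditions (i), (ii) and (iii) (up to simultaneous reordering of the pairs $(\mu_k,P_k)$). Further, for every $1\le j\le m$, $\mu_j$ is a symplectic eigenvalue of $B$ and $P_j$ is the symplectic projection associated with a symplectically orthonormal set of symplectic eigenvector pairs of $B$ corresponding to $\mu_j$.
   Context: Let $J=\begin{bmatrix}O & I_n\\ -I_n & O\end{bmatrix}$ ($2n\times 2n$). A real $2n\times 2n$ matrix $M$ is symplectic if $M^TJM=J$. $\mathbb{P}(2n)$ denotes the set of $2n\times 2n$ real symmetric positive definite matrices. By Williamson's theorem, for every $B\in\mathbb{P}(2n)$ there is a symplectic $M$ with $M^TBM=\begin{bmatrix}D&O\\O&D\end{bmatrix}$, $D=\mathrm{diag}(d_1(B),\dots,d_n(B))$, where $0<d_1(B)\le\dots\le d_n(B)$ are uniquely determined by $B$; they are the symplectic eigenvalues of $B$. $\langle\cdot,\cdot\rangle$ is the Euclidean inner product. A pair $(u,v)$ of vectors in $\mathbb{R}^{2n}$ is a symplectic eigenvector pair of $B$ corresponding to $d$ if $Bu=dJv$ and $Bv=-dJu$.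 A set $S=\{x_1,\dots,x_k,y_1,\dots,y_k\}\subset\mathbb{R}^{2n}$ ($k\ge1$) is symplectically orthonormal if $\langle x_i,Jy_j\rangle=\delta_{ij}$ and $\langle x_i,Jx_j\rangle=\langle y_i,Jy_j\rangle=0$ for all $i,j$. The symplectic projection associated with such a set $S$ is the linear map (identified with its matrix) $$P_S(x)=\sum_{i=1}^{k}\left(\langle x,Jy_i\rangle Jy_i+\langle x,Jx_i\rangle Jx_i\right),\quad x\in\mathbb{R}^{2n};$$ a symplectic projection is any map of the form $P_S$. *)

theory Defs
  imports "HOL-Analysis.Analysis"
begin

text \<open>
  Vectors in the space of dimension 2n are of type \<open>real^('n + 'n)\<close> with \<open>n = CARD('n)\<close>:
  \<open>Inl\<close> indexes the first n coordinates and \<open>Inr\<close> the last n.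
\<close>

definition block_matrix ::
  "real^'n^'n \<Rightarrow> real^'n^'n \<Rightarrow> real^'n^'n \<Rightarrow> real^'n^'n \<Rightarrow> real^('n::finite + 'n)^('n + 'n)" where
  "block_matrix A B C D = (\<chi> i j.
     case i of
       Inl a \<Rightarrow> (case j of Inl b \<Rightarrow> A $ a $ b | Inr b \<Rightarrow> B $ a $ b)
     | Inr a \<Rightarrow> (case j of Inl b \<Rightarrow> C $ a $ b | Inr b \<Rightarrow> D $ a $ b))"

definition diag_matrix :: "('n \<Rightarrow> real) \<Rightarrow> real^('n::finite)^'n" where
  "diag_matrix d = (\<chi> i j. if i = j then d i else 0)"

definition J :: "real^('n::finite + 'n)^('n + 'n)" where
  "J = block_matrix 0 (mat 1) (- mat 1) 0"

definition symplectic :: "real^('n::finite + 'n)^('n + 'n) \<Rightarrow> bool" where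
  "symplectic M \<longleftrightarrow> transpose M ** J ** M = J"

definition positive_definite :: "real^('m::finite)^'m \<Rightarrow> bool" where
  "positive_definite B \<longleftrightarrow> transpose B = B \<and> (\<forall>x. x \<noteq> 0 \<longrightarrow> 0 < x \<bullet> (B *v x))"

text \<open>
  The linear order on the index type \<open>'n\<close> plays the role of the order of 1, ..., n, so that
  \<open>mono d\<close> says that the diagonal entries are listed in increasing order.
\<close>

definition williamson_form ::
  "real^('n::{finite,linorder} + 'n)^('n + 'n) \<Rightarrow> ('n \<Rightarrow> real) \<Rightarrow> bool" where
  "williamson_form B d \<longleftrightarrow> mono d \<and> (\<forall>i. 0 < d i) \<and>
     (\<exists>M. symplectic M \<and>
       transpose M ** B ** M = block_matrix (diag_matrix d) 0 0 (diag_matrix d))"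

definition symplectic_eigenvalue ::
  "real^('n::{finite,linorder} + 'n)^('n + 'n) \<Rightarrow> real \<Rightarrow> bool" where
  "symplectic_eigenvalue B \<mu> \<longleftrightarrow> (\<exists>d. williamson_form B d \<and> \<mu> \<in> range d)"

definition symplectic_eigenvector_pair ::
  "real^('n::finite + 'n)^('n + 'n) \<Rightarrow> real \<Rightarrow> real^('n + 'n) \<Rightarrow> real^('n + 'n) \<Rightarrow> bool" where
  "symplectic_eigenvector_pair B d u v \<longleftrightarrow> B *v u = d *\<^sub>R (J *v v) \<and> B *v v = - d *\<^sub>R (J *v u)"

text \<open>
  A symplectically orthonormal set is given by its size parameter \<open>k\<close> and two families, of which
  only the values at 1, ..., k matter.
\<close>

definition symplectically_orthonormal ::
  "nat \<Rightarrow> (nat \<Rightarrow> real^('n::finite + 'n)) \<Rightarrow> (nat \<Rightarrow> real^('n + 'n)) \<Rightarrow> bool" where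
  "symplectically_orthonormal k x y \<longleftrightarrow> 1 \<le> k \<and>
     (\<forall>i\<in>{1..k}. \<forall>j\<in>{1..k}.
        x i \<bullet> (J *v y j) = (if i = j then 1 else 0) \<and>
        x i \<bullet> (J *v x j) = 0 \<and> y i \<bullet> (J *v y j) = 0)"

definition symplectic_projection_of ::
  "nat \<Rightarrow> (nat \<Rightarrow> real^('n::finite + 'n)) \<Rightarrow> (nat \<Rightarrow> real^('n + 'n)) \<Rightarrow>
   real^('n + 'n)^('n + 'n)" where
  "symplectic_projection_of k x y = matrix (\<lambda>z.
     \<Sum>i=1..k. (z \<bullet> (J *v y i)) *\<^sub>R (J *v y i) + (z \<bullet> (J *v x i)) *\<^sub>R (J *v x i))"

definition symplectic_projection :: "real^('n::finite + 'n)^('n + 'n) \<Rightarrow> bool" where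
  "symplectic_projection P \<longleftrightarrow>
     (\<exists>k x y. symplectically_orthonormal k x y \<and> P = symplectic_projection_of k x y)"

definition symplectic_spectral_decomposition ::
  "real^('n::finite + 'n)^('n + 'n) \<Rightarrow> nat \<Rightarrow> (nat \<Rightarrow> real) \<Rightarrow>
   (nat \<Rightarrow> real^('n + 'n)^('n + 'n)) \<Rightarrow> bool" where
  "symplectic_spectral_decomposition B m \<mu> P \<longleftrightarrow>
     inj_on \<mu> {1..m} \<and>
     (\<forall>k\<in>{1..m}. 0 < \<mu> k) \<and>
     (\<forall>k\<in>{1..m}. symplectic_projection (P k)) \<and>
     (\<forall>j\<in>{1..m}. \<forall>k\<in>{1..m}. j \<noteq> k \<longrightarrow> P j ** J ** P k = 0) \<and>
     (\<Sum>k=1..m. P k ** J ** P k) = J \<and>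
     B = (\<Sum>k=1..m. \<mu> k *\<^sub>R P k)"

end

theory Submission imports Defs begin

text \<open>
  Maximizing \<open>\<langle>u, J v\<rangle>\<close> relative to \<open>\<langle>u, B u\<rangle> + \<langle>v, B v\<rangle>\<close> on successive \<open>J\<close>-orthogonal complements
  produces a symplectic basis of eigenvector pairs of \<open>B\<close>; grouping the pairs by eigenvalue gives
  the decomposition. Conversely, a symplectic projection satisfies \<open>P J P J P = - P\<close>, so in any
  decomposition the matrices \<open>- J P\<^sub>k J P\<^sub>k\<close> are the spectral projections of \<open>- (J B)\<^sup>2\<close> for the
  eigenvalues \<open>\<mu>\<^sub>k\<^sup>2\<close>, which forces uniqueness. From \<open>x\<^sub>i = J P\<^sub>j y\<^sub>i\<close> and \<open>P\<^sub>k J P\<^sub>j = 0\<close> every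
  representation of \<open>P\<^sub>j\<close> consists of eigenvector pairs for \<open>\<mu>\<^sub>j\<close>; pairs with different eigenvalues
  are \<open>J\<close>-orthogonal, so \<open>\<mu>\<^sub>j\<close> must occur in the Williamson form.
\<close>

subsection \<open>Matrix algebra\<close>

lemma sum_matrix_mult_left:
  fixes A :: "'i \<Rightarrow> real^'c^'b" and C :: "real^'b^'a"
  shows "C ** (\<Sum>k\<in>I. A k) = (\<Sum>k\<in>I. C ** A k)"
  by (induction I rule: infinite_finite_induct) (auto simp: matrix_add_ldistrib)

lemma sum_matrix_vector_mult:
  fixes A :: "'i \<Rightarrow> real^'b^'a"
  shows "(\<Sum>k\<in>I. A k) *v x = (\<Sum>k\<in>I. A k *v x)"
  by (induction I rule: infinite_finite_induct) (auto simp: matrix_vector_mult_add_rdistrib)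

lemma sum_matrix_mult_right:
  fixes A :: "'i \<Rightarrow> real^'b^'a" and C :: "real^'c^'b"
  shows "(\<Sum>k\<in>I. A k) ** C = (\<Sum>k\<in>I. A k ** C)"
  by (simp add: matrix_eq matrix_vector_mul_assoc [symmetric] sum_matrix_vector_mult)

lemma matrix_vector_mult_sum:
  fixes A :: "real^'b^'a"
  shows "A *v (\<Sum>k\<in>I. x k) = (\<Sum>k\<in>I. A *v x k)"
  by (induction I rule: infinite_finite_induct) (auto simp: matrix_vector_right_distrib)

lemma matrix_mult_minus_right: "(A :: real^'b^'a) ** - (C :: real^'c^'b) = - (A ** C)"
  by (simp add: matrix_matrix_mult_def vec_eq_iff sum_negf)

lemma matrix_mult_minus_left: "- (A :: real^'b^'a) ** (C :: real^'c^'b) = - (A ** C)"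
  by (simp add: matrix_matrix_mult_def vec_eq_iff sum_negf)

lemma matrix_vector_mult_minus_right: "(A :: real^'b^'a) *v - x = - (A *v x)"
  by (simp add: matrix_vector_mult_def vec_eq_iff sum_negf)

lemma matrix_vector_mult_minus_left: "- (A :: real^'b^'a) *v x = - (A *v x)"
  by (simp add: matrix_vector_mult_def vec_eq_iff sum_negf)

lemma inner_symmetric_matrix:
  fixes B :: "real^'a^'a"
  assumes "transpose B = B"
  shows "x \<bullet> (B *v y) = y \<bullet> (B *v x)"
  by (metis assms dot_lmul_matrix inner_commute transpose_matrix_vector)

text \<open>Turns the matrix equations behind symplectic matrices and the Williamson form into
  pairings of columns.\<close>

lemma transpose_mult_mult_component:
  fixes M A :: "real^'a^'a"
  shows "(transpose M ** A ** M) $ i $ j = column i M \<bullet> (A *v column j M)"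
proof -
  have "(transpose M ** A ** M) $ i $ j = (transpose M ** (A ** M)) $ i $ j"
    by (simp add: matrix_mul_assoc)
  also have "\<dots> = row i (transpose M) \<bullet> column j (A ** M)"
    by (simp add: matrix_matrix_mult_def row_def column_def inner_vec_def)
  also have "column j (A ** M) = A *v column j M"
    by (simp add: column_def matrix_matrix_mult_def matrix_vector_mult_def vec_eq_iff)
  finally show ?thesis by simp
qed

subsection \<open>The symplectic form\<close>

lemma J_component_Inl: "(J *v x) $ Inl a = x $ Inr a"
  and J_component_Inr: "(J *v x) $ Inr a = - x $ Inl a"
  unfolding J_def block_matrix_def matrix_vector_mult_def UNIV_Plus_UNIV [symmetric]
  by (simp_all add: sum.Plus mat_def if_distrib [of "\<lambda>x. x * _"] if_distrib [of uminus]
      cong: if_cong del: UNIV_Plus_UNIV)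

lemma J_J_vec: "J *v (J *v x) = - x"
  unfolding vec_eq_iff
proof
  fix i show "(J *v (J *v x)) $ i = (- x) $ i"
    by (cases i) (simp_all add: J_component_Inl J_component_Inr)
qed

lemma J_mult_J: "J ** J = - mat 1"
  by (simp add: matrix_eq matrix_vector_mul_assoc [symmetric] J_J_vec
      matrix_vector_mult_minus_left)

lemma inner_J_right: "x \<bullet> (J *v y) = - ((J *v x) \<bullet> y)"
  unfolding inner_vec_def UNIV_Plus_UNIV [symmetric]
  by (simp add: sum.Plus J_component_Inl J_component_Inr sum_negf del: UNIV_Plus_UNIV)

lemma inner_J_commute: "x \<bullet> (J *v y) = - (y \<bullet> (J *v x))"
  by (metis inner_J_right inner_commute)

lemma inner_J_self [simp]: "x \<bullet> (J *v x) = 0"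
  using inner_J_commute [of x x] by simp

subsection \<open>Existence of a symplectic basis of eigenvector pairs\<close>

text \<open>First-order condition at a minimum: near 0 the linear term dominates the quadratic one,
  so a nonzero \<open>b\<close> would produce a negative value.\<close>

lemma linear_term_zero_of_nonneg:
  fixes a b :: real
  assumes "\<And>t. 0 \<le> a * t\<^sup>2 + b * t"
  shows "b = 0"
proof (rule ccontr)
  assume "b \<noteq> 0"
  \<comment> \<open>Any positive \<open>s\<close> above \<open>a\<close> serves: the value at
    \<open>- b / s\<close> then has the negative factor \<open>a / s - 1\<close>.\<close>
  define s where "s = \<bar>a\<bar> + 1"
  have s: "0 < s" "a < s" by (auto simp: s_def)
  have "a * (- b / s)\<^sup>2 + b * (- b / s) = b\<^sup>2 / s * (a / s - 1)"
    by (simp add: power2_eq_square algebra_simps diff_divide_distrib)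
  also have "\<dots> < 0"
    using \<open>b \<noteq> 0\<close> s by (intro mult_pos_neg) auto
  finally show False using assms [of "- b / s"] by simp
qed

text \<open>
  The quotient \<open>2 \<langle>u, J v\<rangle> / (\<langle>u, B u\<rangle> + \<langle>v, B v\<rangle>)\<close> attains a maximum \<open>c\<close> on \<open>W \<times> W - {0}\<close>; at a
  maximizer the nonnegative form \<open>c (\<langle>u, B u\<rangle> + \<langle>v, B v\<rangle>) - 2 \<langle>u, J v\<rangle>\<close> vanishes, so the
  maximizer lies in the kernel of that form.
\<close>

lemma exists_restricted_eigenvector_pair:
  fixes B :: "real^('n::finite + 'n)^('n + 'n)"
  assumes B: "positive_definite B" and W: "subspace W"
    and w: "w \<in> W" "w' \<in> W" "0 < w \<bullet> (J *v w')"
  obtains d u v where "0 < d" "u \<in> W" "v \<in> W" "u \<bullet> (J *v v) = 1"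
    "\<And>a. a \<in> W \<Longrightarrow> a \<bullet> (B *v u) = d * (a \<bullet> (J *v v))"
    "\<And>a. a \<in> W \<Longrightarrow> a \<bullet> (B *v v) = - d * (a \<bullet> (J *v u))"
proof -
  define Q where "Q z = fst z \<bullet> (B *v fst z) + snd z \<bullet> (B *v snd z)"
    for z :: "(real^('n + 'n)) \<times> (real^('n + 'n))"
  define \<omega> where "\<omega> z = 2 * (fst z \<bullet> (J *v snd z))"
    for z :: "(real^('n + 'n)) \<times> (real^('n + 'n))"
  have pos: "0 < x \<bullet> (B *v x)" if "x \<noteq> 0" for x
    using B that by (simp add: positive_definite_def)
  have nonneg: "0 \<le> x \<bullet> (B *v x)" for x
    using pos [of x] by (cases "x = 0") auto
  have sym: "x \<bullet> (B *v y) = y \<bullet> (B *v x)" for x y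
    using B by (intro inner_symmetric_matrix) (simp add: positive_definite_def)
  have Q_pos: "0 < Q z" if "z \<noteq> 0" for z
  proof (cases "fst z = 0")
    case True
    then have "snd z \<noteq> 0" using that by (auto simp: prod_eq_iff)
    then show ?thesis using pos nonneg [of "fst z"] by (fastforce simp: Q_def)
  next
    case False
    then show ?thesis using pos nonneg [of "snd z"] by (fastforce simp: Q_def)
  qed
  \<comment> \<open>Both forms are homogeneous of degree 2, so their quotient depends only on the
    direction of \<open>z\<close> and can be maximized over a compact unit sphere.\<close>
  have Q_scale: "Q (r *\<^sub>R z) = r\<^sup>2 * Q z" and \<omega>_scale: "\<omega> (r *\<^sub>R z) = r\<^sup>2 * \<omega> z" for r z
    by (simp_all add: Q_def \<omega>_def matrix_vector_mult_scaleR power2_eq_square algebra_simps)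
  define S where "S = sphere 0 1 \<inter> (W \<times> W)"
  have mem_S: "(1 / norm z) *\<^sub>R z \<in> S" if "z \<noteq> 0" "fst z \<in> W" "snd z \<in> W" for z
    using that W by (auto simp: S_def mem_Times_iff subspace_scale)
  have "compact S"
    unfolding S_def using W by (intro compact_Int_closed closed_Times closed_subspace) auto
  have ww: "(w, w') \<noteq> 0" using w by (auto simp: zero_prod_def)
  then have "S \<noteq> {}" using mem_S [of "(w, w')"] w by auto
  have "continuous_on S (\<lambda>z. \<omega> z / Q z)"
  proof -
    have nz: "\<forall>z\<in>S. Q z \<noteq> 0"
    proof
      fix z assume "z \<in> S"
      then have "norm z = 1" by (simp add: S_def)
      then have "z \<noteq> 0" by auto
      then show "Q z \<noteq> 0" using Q_pos by fastforce
    qed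
    have "continuous_on S (\<lambda>z. A *v fst z)" "continuous_on S (\<lambda>z. A *v snd z)"
      for A :: "real^('n + 'n)^('n + 'n)"
      by (auto intro!: continuous_on_compose2 [OF matrix_vector_mult_linear_continuous_on]
          continuous_intros)
    then show ?thesis
      unfolding Q_def \<omega>_def using nz
      by (intro continuous_intros) (auto simp: Q_def)
  qed
  then obtain z where z: "z \<in> S" "\<And>y. y \<in> S \<Longrightarrow> \<omega> y / Q y \<le> \<omega> z / Q z"
    using continuous_attains_sup [OF \<open>compact S\<close> \<open>S \<noteq> {}\<close>] by blast
  define c where "c = \<omega> z / Q z"
  have z0: "z \<noteq> 0" and zW: "fst z \<in> W" "snd z \<in> W"
    using z(1) by (auto simp: S_def)
  have max: "\<omega> y \<le> c * Q y" if "fst y \<in> W" "snd y \<in> W" for y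
  proof (cases "y = 0")
    case True
    then show ?thesis by (simp add: \<omega>_def Q_def)
  next
    case False
    have "\<omega> ((1 / norm y) *\<^sub>R y) / Q ((1 / norm y) *\<^sub>R y) \<le> c"
      using z(2) mem_S [OF False that] by (simp add: c_def)
    then have "\<omega> y / Q y \<le> c"
      unfolding Q_scale \<omega>_scale using False by simp
    then show ?thesis using Q_pos [OF False] by (simp add: divide_le_eq)
  qed
  \<comment> \<open>The pair \<open>(w, w')\<close> makes \<omega> positive, so the maximum
    \<open>c\<close> is positive too.\<close>
  have "0 < c * Q (w, w')"
    using max [of "(w, w')"] w by (simp add: \<omega>_def)
  then have c: "0 < c"
    using Q_pos [OF ww] by (simp add: zero_less_mult_iff)
  have zeq: "\<omega> z = c * Q z"
    using Q_pos [OF z0] by (simp add: c_def)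
  \<comment> \<open>Stationarity of \<open>c * Q - \<omega>\<close> at \<open>z\<close> in the
    direction \<open>(a, b)\<close>. Setting \<open>b = 0\<close> or \<open>a = 0\<close> later
    separates the two eigenvector equations.\<close>
  have crit: "c * (a \<bullet> (B *v fst z) + b \<bullet> (B *v snd z)) = a \<bullet> (J *v snd z) + fst z \<bullet> (J *v b)"
    if "a \<in> W" "b \<in> W" for a b
  proof -
    \<comment> \<open>\<open>l\<close> is the coefficient of \<open>t\<close> in
      \<open>c * Q - \<omega>\<close> along \<open>z + t *\<^sub>R (a, b)\<close>; the constant term
      vanishes by \<open>zeq\<close>.\<close>
    define l where "l = 2 * (c * (a \<bullet> (B *v fst z) + b \<bullet> (B *v snd z))
        - (a \<bullet> (J *v snd z) + fst z \<bullet> (J *v b)))"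
    have "l = 0"
    proof (rule linear_term_zero_of_nonneg)
      fix t :: real
      let ?y = "z + t *\<^sub>R (a, b)"
      have "0 \<le> c * Q ?y - \<omega> ?y"
        using max [of ?y] zW that W by (simp add: subspace_add subspace_scale)
      also have "Q ?y = Q z + 2 * t * (a \<bullet> (B *v fst z) + b \<bullet> (B *v snd z)) + t\<^sup>2 * Q (a, b)"
        using sym [of "fst z" a] sym [of "snd z" b]
        by (simp add: Q_def matrix_vector_right_distrib matrix_vector_mult_scaleR inner_add_left
            inner_add_right power2_eq_square algebra_simps)
      also have "\<omega> ?y = \<omega> z + 2 * t * (a \<bullet> (J *v snd z) + fst z \<bullet> (J *v b)) + t\<^sup>2 * \<omega> (a, b)"
        by (simp add: \<omega>_def matrix_vector_right_distrib matrix_vector_mult_scaleR inner_add_left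
            inner_add_right power2_eq_square algebra_simps)
      finally show "0 \<le> (c * Q (a, b) - \<omega> (a, b)) * t\<^sup>2 + l * t"
        using zeq by (simp add: l_def algebra_simps)
    qed
    then show ?thesis by (simp add: l_def)
  qed
  \<comment> \<open>Scaling both components of \<open>z\<close> by \<open>1 / sqrt s\<close> makes
    their symplectic product 1 and preserves \<open>crit\<close>, whose form shows that the
    eigenvalue is \<open>1 / c\<close>.\<close>
  define s where "s = fst z \<bullet> (J *v snd z)"
  have "0 < \<omega> z" using zeq c Q_pos [OF z0] by simp
  then have s: "0 < s" by (simp add: s_def \<omega>_def)
  show thesis
  proof
    let ?u = "(1 / sqrt s) *\<^sub>R fst z" and ?v = "(1 / sqrt s) *\<^sub>R snd z"
    show "0 < 1 / c" using c by simp
    show "?u \<in> W" "?v \<in> W" using zW W by (auto intro: subspace_scale)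
    show "?u \<bullet> (J *v ?v) = 1"
      using s by (simp add: matrix_vector_mult_scaleR s_def [symmetric])
    show "a \<bullet> (B *v ?u) = 1 / c * (a \<bullet> (J *v ?v))" if "a \<in> W" for a
      using crit [OF that subspace_0 [OF W]] c s
      by (simp add: matrix_vector_mult_scaleR field_simps)
    show "a \<bullet> (B *v ?v) = - (1 / c) * (a \<bullet> (J *v ?u))" if "a \<in> W" for a
      using crit [OF subspace_0 [OF W] that] c s inner_J_commute [of a "fst z"]
      by (simp add: matrix_vector_mult_scaleR field_simps)
  qed
qed


text \<open>Unlike \<open>symplectically_orthonormal\<close>, this allows any index set: the empty
  one starts the induction, and subsets of a basis arise when pairs are grouped by
  eigenvalue.\<close>

definition symplectic_family ::
  "'i set \<Rightarrow> ('i \<Rightarrow> real^('n::finite + 'n)) \<Rightarrow> ('i \<Rightarrow> real^('n + 'n)) \<Rightarrow> bool" where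
  "symplectic_family I u v \<longleftrightarrow> (\<forall>i\<in>I. \<forall>j\<in>I.
     u i \<bullet> (J *v v j) = (if i = j then 1 else 0) \<and>
     u i \<bullet> (J *v u j) = 0 \<and> v i \<bullet> (J *v v j) = 0)"

lemma symplectic_familyD:
  assumes "symplectic_family I u v" "i \<in> I" "j \<in> I"
  shows "u i \<bullet> (J *v v j) = (if i = j then 1 else 0)"
    and "v i \<bullet> (J *v u j) = (if i = j then - 1 else 0)"
    and "u i \<bullet> (J *v u j) = 0" and "v i \<bullet> (J *v v j) = 0"
  using assms inner_J_commute [of "v i" "u j"] by (auto simp: symplectic_family_def)

text \<open>Symplectic Gram-Schmidt: pairing the subtracted sum with \<open>J *v u j\<close> or
  \<open>J *v v j\<close> leaves one term, which cancels the pairing of \<open>z\<close>.\<close>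

lemma symplectic_family_remainder:
  fixes z :: "real^('n::finite + 'n)"
  assumes fam: "symplectic_family I u v" and "finite I" "j \<in> I"
  defines "r \<equiv> z - (\<Sum>i\<in>I. (z \<bullet> (J *v v i)) *\<^sub>R u i - (z \<bullet> (J *v u i)) *\<^sub>R v i)"
  shows "r \<bullet> (J *v u j) = 0" and "r \<bullet> (J *v v j) = 0"
proof -
  have "r \<bullet> (J *v u j) = z \<bullet> (J *v u j) - (\<Sum>i\<in>I. if i = j then z \<bullet> (J *v u i) else 0)"
    unfolding r_def inner_diff_left inner_sum_left
    using symplectic_familyD [OF fam _ \<open>j \<in> I\<close>] by (auto intro!: sum.cong)
  then show "r \<bullet> (J *v u j) = 0" using assms by simp
  have "r \<bullet> (J *v v j) = z \<bullet> (J *v v j) - (\<Sum>i\<in>I. if i = j then z \<bullet> (J *v v i) else 0)"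
    unfolding r_def inner_diff_left inner_sum_left
    using symplectic_familyD [OF fam _ \<open>j \<in> I\<close>] by (auto intro!: sum.cong)
  then show "r \<bullet> (J *v v j) = 0" using assms by simp
qed

text \<open>Dimension count: with an index missing from \<open>I\<close>, the vectors to be avoided
  number fewer than the dimension and cannot span the space.\<close>

lemma exists_J_orthogonal:
  fixes u v :: "'n::finite \<Rightarrow> real^('n + 'n)"
  assumes "a \<notin> I"
  obtains w where "w \<noteq> 0" "\<And>i. i \<in> I \<Longrightarrow> w \<bullet> (J *v u i) = 0 \<and> w \<bullet> (J *v v i) = 0"
proof -
  let ?T = "(\<lambda>i. J *v u i) ` I \<union> (\<lambda>i. J *v v i) ` I"
  have "card ?T \<le> card I + card I"
    by (intro order_trans [OF card_Un_le] add_mono card_image_le) auto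
  also have "card I < CARD('n)"
    using assms by (intro psubset_card_mono) auto
  finally have "card ?T < DIM(real^('n + 'n))"
    by simp
  then have "dim ?T < DIM(real^('n + 'n))"
    using dim_le_card' [of ?T] by simp
  then have "span ?T \<noteq> UNIV"
    by (metis dim_UNIV dim_span less_irrefl)
  then obtain w where "w \<noteq> 0" "\<forall>x\<in>span ?T. w \<bullet> x = 0"
    using span_not_UNIV_orthogonal by blast
  then show thesis
    by (intro that [of w]) (auto intro: span_base)
qed

text \<open>Each induction step finds a new pair in the \<open>J\<close>-orthogonal complement
  \<open>W\<close> of the earlier ones. Its equations, tested only against \<open>W\<close>, extend
  to the whole space because both sides vanish against the earlier pairs.\<close>

lemma exists_symplectic_family_of_eigenvector_pairs:
  fixes B :: "real^('n::finite + 'n)^('n + 'n)" and I :: "'n set"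
  assumes B: "positive_definite B"
  shows "\<exists>u v d. symplectic_family I u v \<and>
    (\<forall>i\<in>I. 0 < d i \<and> symplectic_eigenvector_pair B (d i) (u i) (v i))"
proof (induction I rule: finite_induct [OF finite])
  case 1
  show ?case by (simp add: symplectic_family_def)
next
  case (2 a I)
  then obtain u v d where fam: "symplectic_family I u v" and d: "\<And>i. i \<in> I \<Longrightarrow> 0 < d i"
    and pair: "\<And>i. i \<in> I \<Longrightarrow> symplectic_eigenvector_pair B (d i) (u i) (v i)"
    by blast
  have sym: "x \<bullet> (B *v y) = y \<bullet> (B *v x)" for x y
    using B by (intro inner_symmetric_matrix) (simp add: positive_definite_def)
  define W where "W = {w. \<forall>i\<in>I. w \<bullet> (J *v u i) = 0 \<and> w \<bullet> (J *v v i) = 0}"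
  have W: "subspace W"
    by (auto simp: W_def subspace_def inner_add_left)
  define rem where "rem z = z - (\<Sum>i\<in>I. (z \<bullet> (J *v v i)) *\<^sub>R u i - (z \<bullet> (J *v u i)) *\<^sub>R v i)" for z
  have rem_W: "rem z \<in> W" for z
    using symplectic_family_remainder [OF fam \<open>finite I\<close>] by (simp add: W_def rem_def)
  \<comment> \<open>\<open>W\<close> and the earlier pairs together span the space, as the splitting
    by \<open>rem\<close> shows.\<close>
  have full: "x = y" if W_eq: "\<And>b. b \<in> W \<Longrightarrow> b \<bullet> x = b \<bullet> y"
    and I_eq: "\<And>i. i \<in> I \<Longrightarrow> u i \<bullet> x = u i \<bullet> y \<and> v i \<bullet> x = v i \<bullet> y" for x y
  proof -
    have "z \<bullet> x = z \<bullet> y" for z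
    proof -
      have z: "z = rem z + (\<Sum>i\<in>I. (z \<bullet> (J *v v i)) *\<^sub>R u i - (z \<bullet> (J *v u i)) *\<^sub>R v i)"
        by (simp add: rem_def)
      show ?thesis
        by (subst (1 2) z) (simp add: inner_add_left inner_sum_left inner_diff_left W_eq rem_W I_eq)
    qed
    then show ?thesis by (metis inner_commute vector_eq_rdot)
  qed
  obtain w where "w \<noteq> 0" "\<And>i. i \<in> I \<Longrightarrow> w \<bullet> (J *v u i) = 0 \<and> w \<bullet> (J *v v i) = 0"
    using exists_J_orthogonal [OF \<open>a \<notin> I\<close>, of u v] by blast
  then have w: "w \<noteq> 0" "w \<in> W"
    by (auto simp: W_def)
  \<comment> \<open>The partner of \<open>w\<close> is \<open>- (J *v w)\<close> projected into
    \<open>W\<close>: the correction is invisible to \<open>w\<close>, which is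
    \<open>J\<close>-orthogonal to the family, and the product is
    \<open>w \<bullet> w\<close>.\<close>
  have "w \<bullet> (J *v rem (- (J *v w))) = w \<bullet> (J *v (- (J *v w)))"
    using w(2) by (simp add: rem_def W_def matrix_vector_mult_diff_distrib matrix_vector_mult_sum
        matrix_vector_mult_scaleR inner_diff_right inner_sum_right)
  also have "\<dots> = w \<bullet> w"
    by (simp add: matrix_vector_mult_minus_right J_J_vec)
  finally have "0 < w \<bullet> (J *v rem (- (J *v w)))"
    using w(1) by simp
  then obtain e p q where e: "0 < e" and pq: "p \<in> W" "q \<in> W" "p \<bullet> (J *v q) = 1"
    and Bp: "\<And>b. b \<in> W \<Longrightarrow> b \<bullet> (B *v p) = e * (b \<bullet> (J *v q))"
    and Bq: "\<And>b. b \<in> W \<Longrightarrow> b \<bullet> (B *v q) = - e * (b \<bullet> (J *v p))"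
    using exists_restricted_eigenvector_pair [OF B W w(2) rem_W] by metis
  \<comment> \<open>\<open>B\<close> sends an earlier pair to multiples of its
    \<open>J\<close>-images, so symmetry of \<open>B\<close> turns \<open>J\<close>-orthogonality of
    \<open>x\<close> into orthogonality of \<open>B *v x\<close>.\<close>
  have orth: "u i \<bullet> (B *v x) = 0" "v i \<bullet> (B *v x) = 0" "u i \<bullet> (J *v x) = 0" "v i \<bullet> (J *v x) = 0"
    if "i \<in> I" "x \<in> W" for i x
    using that pair [of i] inner_J_commute [of "u i" x] inner_J_commute [of "v i" x]
    by (auto simp: symplectic_eigenvector_pair_def W_def sym [of "u i" x] sym [of "v i" x])
  have "B *v p = e *\<^sub>R (J *v q)"
    by (rule full) (use Bp orth pq in auto)
  moreover have "B *v q = - e *\<^sub>R (J *v p)"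
    by (rule full) (use Bq orth pq in auto)
  ultimately have ep: "symplectic_eigenvector_pair B e p q"
    by (simp add: symplectic_eigenvector_pair_def)
  have "symplectic_family (insert a I) (u(a := p)) (v(a := q))"
  proof -
    have in_W: "x \<bullet> (J *v u i) = 0" "x \<bullet> (J *v v i) = 0" if "x \<in> W" "i \<in> I" for x i
      using that by (simp_all add: W_def)
    have ne: "a \<noteq> i" if "i \<in> I" for i
      using that \<open>a \<notin> I\<close> by blast
    show ?thesis
      unfolding symplectic_family_def
      by (simp add: pq orth in_W symplectic_familyD [OF fam] ne ne [symmetric] \<open>a \<notin> I\<close>)
  qed
  moreover have "\<forall>i\<in>insert a I. 0 < (d(a := e)) i \<and>
      symplectic_eigenvector_pair B ((d(a := e)) i) ((u(a := p)) i) ((v(a := q)) i)"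
    using d pair e ep by simp
  ultimately show ?case by blast
qed

subsection \<open>Symplectic bases and Williamson's theorem\<close>

definition basis_matrix ::
  "('n \<Rightarrow> real^('n::finite + 'n)) \<Rightarrow> ('n \<Rightarrow> real^('n + 'n)) \<Rightarrow> real^('n + 'n)^('n + 'n)" where
  "basis_matrix u v = (\<chi> i j. case j of Inl a \<Rightarrow> u a $ i | Inr a \<Rightarrow> v a $ i)"

lemma column_basis_matrix [simp]:
  "column (Inl a) (basis_matrix u v) = u a" "column (Inr a) (basis_matrix u v) = v a"
  by (simp_all add: column_def basis_matrix_def vec_eq_iff)

lemma block_matrix_eq_iff:
  "M = block_matrix A B C D \<longleftrightarrow> (\<forall>a b. M $ Inl a $ Inl b = A $ a $ b \<and> M $ Inl a $ Inr b = B $ a $ b \<and>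
     M $ Inr a $ Inl b = C $ a $ b \<and> M $ Inr a $ Inr b = D $ a $ b)"
proof -
  have all_sum: "(\<forall>i. P i) \<longleftrightarrow> (\<forall>a. P (Inl a)) \<and> (\<forall>a. P (Inr a))" for P :: "'x + 'x \<Rightarrow> bool"
    by (metis sum.exhaust)
  show ?thesis
    by (auto simp: vec_eq_iff block_matrix_def all_sum)
qed

lemma symplectic_iff_columns:
  "symplectic M \<longleftrightarrow> symplectic_family UNIV (\<lambda>a. column (Inl a) M) (\<lambda>a. column (Inr a) M)"
proof -
  have "symplectic M \<longleftrightarrow> transpose M ** J ** M = block_matrix 0 (mat 1) (- mat 1) 0"
    by (simp add: symplectic_def J_def)
  also have "\<dots> \<longleftrightarrow> symplectic_family UNIV (\<lambda>a. column (Inl a) M) (\<lambda>a. column (Inr a) M)"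
    (is "_ \<longleftrightarrow> symplectic_family UNIV ?u ?v")
    unfolding block_matrix_eq_iff transpose_mult_mult_component symplectic_family_def
    using inner_J_commute [of "?v _" "?u _"] by (auto simp: mat_def)
  finally show ?thesis .
qed

text \<open>Since \<open>J ** J = - mat 1\<close>, the defining equation exhibits
  \<open>- (J ** transpose M ** J)\<close> as a left inverse.\<close>

lemma symplectic_invertible:
  assumes "symplectic M"
  obtains N where "M ** N = mat 1" "N ** M = mat 1"
proof -
  have "(- (J ** transpose M ** J)) ** M = - (J ** (transpose M ** J ** M))"
    by (simp add: matrix_mult_minus_left matrix_mul_assoc)
  also have "\<dots> = mat 1"
    using assms by (simp add: symplectic_def J_mult_J)
  finally show thesis
    using that matrix_left_right_inverse by blast
qed

lemma symplectic_basis_matrix: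
  assumes "symplectic_family UNIV u v"
  shows "symplectic (basis_matrix u v)"
  using assms by (simp add: symplectic_iff_columns)

text \<open>The inner products are the entries of the transposed basis matrix applied to the vector,
  and that matrix is invertible.\<close>

lemma symplectic_basis_inner_ext:
  fixes u v :: "'n::finite \<Rightarrow> real^('n + 'n)"
  assumes "symplectic_family UNIV u v"
    and "\<And>a. u a \<bullet> x = u a \<bullet> y" and "\<And>a. v a \<bullet> x = v a \<bullet> y"
  shows "x = y"
proof -
  let ?M = "basis_matrix u v"
  have entry: "(transpose ?M *v z) $ i = column i ?M \<bullet> z" for i z
    by (simp add: matrix_vector_mult_def transpose_def column_def inner_vec_def)
  have "transpose ?M *v x = transpose ?M *v y"
    unfolding vec_eq_iff
  proof
    fix i show "(transpose ?M *v x) $ i = (transpose ?M *v y) $ i"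
      by (cases i) (simp_all only: entry column_basis_matrix assms)
  qed
  moreover obtain N where "?M ** N = mat 1"
    using symplectic_invertible [OF symplectic_basis_matrix [OF assms(1)]] by metis
  then have "transpose N ** transpose ?M = mat 1"
    by (metis matrix_transpose_mul transpose_mat)
  ultimately show ?thesis
    by (metis matrix_vector_mul_assoc matrix_vector_mul_lid)
qed

lemma symplectic_basis_matrix_ext:
  fixes u v :: "'n::finite \<Rightarrow> real^('n + 'n)" and A C :: "real^('n + 'n)^('n + 'n)"
  assumes "symplectic_family UNIV u v"
    and "\<And>a. A *v u a = C *v u a" and "\<And>a. A *v v a = C *v v a"
  shows "A = C"
proof -
  let ?M = "basis_matrix u v"
  have col: "column i (E ** ?M) = E *v column i ?M" for i and E :: "real^('n + 'n)^('n + 'n)"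
    by (simp add: column_def matrix_matrix_mult_def matrix_vector_mult_def vec_eq_iff)
  have "column i (A ** ?M) = column i (C ** ?M)" for i
    using assms by (cases i) (simp_all add: col)
  then have "A ** ?M = C ** ?M"
    by (simp add: column_def vec_eq_iff)
  moreover obtain N where "?M ** N = mat 1"
    using symplectic_invertible [OF symplectic_basis_matrix [OF assms(1)]] by metis
  ultimately show ?thesis
    by (metis matrix_mul_assoc matrix_mul_rid)
qed

text \<open>The columns of \<open>M\<close> are the pairs: the entries of
  \<open>transpose M ** B ** M\<close> are the inner products of \<open>B\<close>-images with the
  columns, and these determine the images.\<close>

lemma williamson_form_iff_eigenvector_pairs:
  fixes B :: "real^('n::{finite,linorder} + 'n)^('n + 'n)"
  shows "williamson_form B d \<longleftrightarrow> mono d \<and> (\<forall>i. 0 < d i) \<and>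
    (\<exists>u v. symplectic_family UNIV u v \<and> (\<forall>i. symplectic_eigenvector_pair B (d i) (u i) (v i)))"
proof -
  let ?D = "block_matrix (diag_matrix d) 0 0 (diag_matrix d)"
  have "(\<exists>M. symplectic M \<and> transpose M ** B ** M = ?D) \<longleftrightarrow>
    (\<exists>u v. symplectic_family UNIV u v \<and> (\<forall>i. symplectic_eigenvector_pair B (d i) (u i) (v i)))"
    (is "?L \<longleftrightarrow> ?R")
  proof
    assume ?L
    then obtain M where M: "symplectic M" "transpose M ** B ** M = ?D" by blast
    let ?u = "\<lambda>a. column (Inl a) M" and ?v = "\<lambda>a. column (Inr a) M"
    have fam: "symplectic_family UNIV ?u ?v"
      using M(1) by (simp add: symplectic_iff_columns)
    have D: "?u a \<bullet> (B *v ?u b) = (if a = b then d a else 0)" "?u a \<bullet> (B *v ?v b) = 0"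
      "?v a \<bullet> (B *v ?u b) = 0" "?v a \<bullet> (B *v ?v b) = (if a = b then d a else 0)" for a b
      using M(2) unfolding block_matrix_eq_iff transpose_mult_mult_component
      by (simp_all add: diag_matrix_def)
    have "B *v ?u b = d b *\<^sub>R (J *v ?v b)" "B *v ?v b = - d b *\<^sub>R (J *v ?u b)" for b
      by (rule symplectic_basis_inner_ext [OF fam]; simp add: D symplectic_familyD [OF fam])+
    then show ?R
      using fam unfolding symplectic_eigenvector_pair_def by blast
  next
    assume ?R
    then obtain u v where fam: "symplectic_family UNIV u v"
      and pair: "\<And>i. symplectic_eigenvector_pair B (d i) (u i) (v i)" by blast
    have "transpose (basis_matrix u v) ** B ** basis_matrix u v = ?D"
      unfolding block_matrix_eq_iff transpose_mult_mult_component
      using pair symplectic_familyD [OF fam]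
      by (simp add: symplectic_eigenvector_pair_def diag_matrix_def)
    with symplectic_basis_matrix [OF fam] show ?L by blast
  qed
  then show ?thesis by (simp add: williamson_form_def)
qed

lemma exists_mono_permutation:
  fixes d :: "'n::{finite,linorder} \<Rightarrow> 'a::linorder"
  obtains p :: "'n \<Rightarrow> 'n" where "bij p" "mono (d \<circ> p)"
proof -
  let ?L = "sort_key d (sorted_list_of_set (UNIV :: 'n set))"
  \<comment> \<open>\<open>?r i\<close> is the zero-based rank of \<open>i\<close>, hence a valid
    index into the sorted list \<open>?L\<close>.\<close>
  let ?r = "\<lambda>i :: 'n. card {..<i}"
  have L: "distinct ?L" "set ?L = UNIV" "length ?L = CARD('n)"
    by simp_all
  have r_mono: "?r i \<le> ?r j" if "i \<le> j" for i j
    using that by (intro card_mono) auto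
  have r_less: "?r i < ?r j" if "i < j" for i j
    using that by (intro psubset_card_mono) auto
  have r_lt: "?r i < CARD('n)" for i
    by (intro psubset_card_mono) auto
  have "inj (\<lambda>i. ?L ! ?r i)"
  proof (rule injI)
    fix i j assume "?L ! ?r i = ?L ! ?r j"
    then have "?r i = ?r j"
      using nth_eq_iff_index_eq L r_lt by metis
    then show "i = j"
      using r_less by (metis less_irrefl linorder_less_linear)
  qed
  then have "bij (\<lambda>i. ?L ! ?r i)"
    by (simp add: bij_def finite_UNIV_inj_surj)
  moreover have "mono (d \<circ> (\<lambda>i. ?L ! ?r i))"
  proof (rule monoI)
    fix i j :: 'n assume "i \<le> j"
    have "sorted (map d ?L)" by (rule sorted_sort_key)
    then have "map d ?L ! ?r i \<le> map d ?L ! ?r j"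
      using r_mono [OF \<open>i \<le> j\<close>] r_lt L(3) by (intro sorted_nth_mono) simp_all
    then show "(d \<circ> (\<lambda>i. ?L ! ?r i)) i \<le> (d \<circ> (\<lambda>i. ?L ! ?r i)) j"
      using r_lt L(3) by simp
  qed
  ultimately show thesis by (rule that)
qed

text \<open>A symplectic basis of eigenvector pairs stays symplectic under a bijective reindexing,
  which is chosen to sort the eigenvalues.\<close>

theorem williamson:
  fixes B :: "real^('n::{finite,linorder} + 'n)^('n + 'n)"
  assumes "positive_definite B"
  obtains d where "williamson_form B d"
proof -
  obtain u v :: "'n \<Rightarrow> real^('n + 'n)" and d
    where fam: "symplectic_family UNIV u v" and "\<And>i. 0 < d i"
      and "\<And>i. symplectic_eigenvector_pair B (d i) (u i) (v i)"
    using exists_symplectic_family_of_eigenvector_pairs [OF assms, of UNIV] by auto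
  moreover obtain p :: "'n \<Rightarrow> 'n" where p: "bij p" "mono (d \<circ> p)"
    by (rule exists_mono_permutation)
  moreover have "symplectic_family UNIV (u \<circ> p) (v \<circ> p)"
    using symplectic_familyD [OF fam] bij_is_inj [OF p(1)]
    by (simp add: symplectic_family_def inj_eq)
  ultimately have "williamson_form B (d \<circ> p)"
    unfolding williamson_form_iff_eigenvector_pairs
    by - (intro conjI, simp_all only: comp_apply, blast,
        rule exI [of _ "u \<circ> p"], rule exI [of _ "v \<circ> p"], simp)
  then show thesis by (rule that)
qed

text \<open>Symmetry of \<open>B\<close> evaluates each mixed product in two ways. The symplectic
  products then satisfy \<open>d * p = e * q\<close> and \<open>d * q = e * p\<close>, which forces
  zero as the squares of \<open>d\<close> and \<open>e\<close> differ.\<close>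

lemma eigenvector_pairs_J_orthogonal:
  fixes B :: "real^('n::finite + 'n)^('n + 'n)"
  assumes B: "transpose B = B" and "0 < d" "0 < e" "d \<noteq> e"
    and uv: "symplectic_eigenvector_pair B d u v" and xy: "symplectic_eigenvector_pair B e x y"
  shows "u \<bullet> (J *v x) = 0" and "v \<bullet> (J *v x) = 0"
proof -
  have nz: "p = 0" if "d * p = e * q" "d * q = e * p" for p q :: real
  proof -
    have "d * d * p = e * e * p" using that by (metis mult.assoc mult.left_commute)
    moreover have "d * d \<noteq> e * e"
      using assms(2-4) by (simp add: square_eq_iff)
    ultimately show ?thesis by auto
  qed
  have eqs: "d * (x \<bullet> (J *v v)) = e * (u \<bullet> (J *v y))" "- (d * (y \<bullet> (J *v u))) = - (e * (v \<bullet> (J *v x)))"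
    "- (d * (x \<bullet> (J *v u))) = e * (v \<bullet> (J *v y))" "d * (y \<bullet> (J *v v)) = - (e * (u \<bullet> (J *v x)))"
    using inner_symmetric_matrix [OF B, of x u] inner_symmetric_matrix [OF B, of y v]
      inner_symmetric_matrix [OF B, of x v] inner_symmetric_matrix [OF B, of y u] uv xy
    by (simp_all add: symplectic_eigenvector_pair_def)
  show "u \<bullet> (J *v x) = 0"
    by (rule nz [of _ "v \<bullet> (J *v y)"])
      (use eqs inner_J_commute [of x u] inner_J_commute [of y v] in auto)
  show "v \<bullet> (J *v x) = 0"
    by (rule nz [of _ "- (u \<bullet> (J *v y))"])
      (use eqs inner_J_commute [of x v] inner_J_commute [of y u] in auto)
qed

text \<open>If \<open>e\<close> were missing from the Williamson list, \<open>x\<close> would be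
  \<open>J\<close>-orthogonal to a whole symplectic basis, hence zero.\<close>

lemma symplectic_eigenvalue_of_pair:
  fixes B :: "real^('n::{finite,linorder} + 'n)^('n + 'n)"
  assumes B: "positive_definite B" and "0 < e" "symplectic_eigenvector_pair B e x y" "x \<noteq> 0"
  shows "symplectic_eigenvalue B e"
proof -
  obtain d where d: "williamson_form B d"
    using williamson [OF B] .
  then obtain u v where fam: "symplectic_family UNIV u v" and "\<And>i. 0 < d i"
    and "\<And>i. symplectic_eigenvector_pair B (d i) (u i) (v i)"
    unfolding williamson_form_iff_eigenvector_pairs by blast
  have "J *v x = 0" if "e \<notin> range d"
  proof (rule symplectic_basis_inner_ext [OF fam])
    fix a
    have "d a \<noteq> e" using that by auto
    then show "u a \<bullet> (J *v x) = u a \<bullet> 0" "v a \<bullet> (J *v x) = v a \<bullet> 0"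
      using eigenvector_pairs_J_orthogonal [of B "d a" e "u a" "v a" x y] assms \<open>0 < d a\<close>
        \<open>symplectic_eigenvector_pair B (d a) (u a) (v a)\<close>
      by (simp_all add: positive_definite_def)
  qed
  then have "e \<in> range d"
    using J_J_vec [of x] \<open>x \<noteq> 0\<close> by fastforce
  then show ?thesis using d by (auto simp: symplectic_eigenvalue_def)
qed


subsection \<open>Symplectic projections\<close>

text \<open>General index sets let the projections of all eigenvalues be cut out of a single
  basis.\<close>

definition family_projection ::
  "'i set \<Rightarrow> ('i \<Rightarrow> real^('n::finite + 'n)) \<Rightarrow> ('i \<Rightarrow> real^('n + 'n)) \<Rightarrow> real^('n + 'n)^('n + 'n)" where
  "family_projection I u v = matrix (\<lambda>z.
     \<Sum>i\<in>I. (z \<bullet> (J *v v i)) *\<^sub>R (J *v v i) + (z \<bullet> (J *v u i)) *\<^sub>R (J *v u i))"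

lemma symplectic_projection_of_eq: "symplectic_projection_of k x y = family_projection {1..k} x y"
  by (simp add: symplectic_projection_of_def family_projection_def)

lemma symplectically_orthonormal_iff:
  "symplectically_orthonormal k x y \<longleftrightarrow> 1 \<le> k \<and> symplectic_family {1..k} x y"
  by (simp add: symplectically_orthonormal_def symplectic_family_def)

lemma family_projection_vec:
  "family_projection I u v *v z =
    (\<Sum>i\<in>I. (z \<bullet> (J *v v i)) *\<^sub>R (J *v v i) + (z \<bullet> (J *v u i)) *\<^sub>R (J *v u i))"
  unfolding family_projection_def
  by (subst matrix_vector_mul, rule linearI)
    (simp_all add: inner_add_left scaleR_add_left sum.distrib scaleR_sum_right scaleR_add_right
      algebra_simps)

text \<open>Used with \<open>K = I\<close> for the projection's own vectors and with
  \<open>K = UNIV\<close> for its action on a complete basis.\<close>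

lemma family_projection_basis:
  assumes fam: "symplectic_family K u v" and "I \<subseteq> K" "finite I" "a \<in> K"
  shows "family_projection I u v *v u a = (if a \<in> I then J *v v a else 0)"
    and "family_projection I u v *v v a = (if a \<in> I then - (J *v u a) else 0)"
proof -
  have "family_projection I u v *v u a = (\<Sum>i\<in>I. if a = i then J *v v i else 0)"
    unfolding family_projection_vec using symplectic_familyD [OF fam \<open>a \<in> K\<close>] \<open>I \<subseteq> K\<close>
    by (intro sum.cong) auto
  then show "family_projection I u v *v u a = (if a \<in> I then J *v v a else 0)"
    using \<open>finite I\<close> by simp
  have "family_projection I u v *v v a = (\<Sum>i\<in>I. if a = i then - (J *v u i) else 0)"
    unfolding family_projection_vec using symplectic_familyD [OF fam \<open>a \<in> K\<close>] \<open>I \<subseteq> K\<close>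
    by (intro sum.cong) auto
  then show "family_projection I u v *v v a = (if a \<in> I then - (J *v u a) else 0)"
    using \<open>finite I\<close> by simp
qed

lemma symplectic_projection_family:
  assumes fam: "symplectic_family K u v" and "I \<subseteq> K" "finite I" "I \<noteq> {}"
  shows "symplectic_projection (family_projection I u v)"
proof -
  obtain h where h: "bij_betw h {1..card I} I"
    using ex_bij_betw_nat_finite_1 [OF \<open>finite I\<close>] by blast
  have "h i \<in> K" if "i \<in> {1..card I}" for i
    using bij_betwE [OF h] that \<open>I \<subseteq> K\<close> by blast
  moreover have "h i = h j \<longleftrightarrow> i = j" if "i \<in> {1..card I}" "j \<in> {1..card I}" for i j
    using inj_on_eq_iff [OF bij_betw_imp_inj_on [OF h]] that by blast
  ultimately have "symplectic_family {1..card I} (u \<circ> h) (v \<circ> h)"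
    using symplectic_familyD [OF fam] unfolding symplectic_family_def by (metis comp_apply)
  moreover have "1 \<le> card I"
    using assms by (simp add: Suc_le_eq card_gt_0_iff)
  moreover have "family_projection I u v = family_projection {1..card I} (u \<circ> h) (v \<circ> h)"
    unfolding family_projection_def by (simp add: sum.reindex_bij_betw [OF h, symmetric])
  ultimately show ?thesis
    unfolding symplectic_projection_def symplectically_orthonormal_iff symplectic_projection_of_eq
    by blast
qed

text \<open>The range of \<open>P\<close> is spanned by the vectors \<open>J *v x i\<close> and
  \<open>J *v y i\<close>. There \<open>P ** J\<close> sends the first to minus the second and the
  second to the first, so its square is minus the identity.\<close>

lemma symplectic_projection_cube:
  assumes "symplectic_projection P"
  shows "P ** J ** P ** J ** P = - P"
proof -
  obtain k :: nat and x y where fam: "symplectic_family {1..k} x y" and P: "P = family_projection {1..k} x y"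
    using assms unfolding symplectic_projection_def symplectically_orthonormal_iff
      symplectic_projection_of_eq by blast
  have PJ: "P *v (J *v (J *v x i)) = - (J *v y i)" "P *v (J *v (J *v y i)) = J *v x i"
    if "i \<in> {1..k}" for i
    using that family_projection_basis [OF fam subset_refl finite_atLeastAtMost that]
    by (simp_all add: P J_J_vec matrix_vector_mult_minus_right)
  have "P *v (J *v (P *v (J *v (P *v z)))) = - (P *v z)" for z
  proof -
    have z: "P *v z = (\<Sum>i=1..k. (z \<bullet> (J *v y i)) *\<^sub>R (J *v y i) + (z \<bullet> (J *v x i)) *\<^sub>R (J *v x i))"
      by (simp add: P family_projection_vec)
    show ?thesis
      unfolding z
      by (simp add: matrix_vector_mult_sum matrix_vector_right_distrib
          matrix_vector_mult_diff_distrib matrix_vector_mult_scaleR PJ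
          matrix_vector_mult_minus_right sum_negf [symmetric])
  qed
  then show ?thesis
    by (simp add: matrix_eq matrix_vector_mul_assoc [symmetric] matrix_vector_mult_minus_left)
qed

text \<open>A symplectically orthonormal set has at least one pair, and \<open>P\<close> does not
  kill \<open>x 1\<close>.\<close>

lemma symplectic_projection_nonzero:
  assumes "symplectic_projection P"
  shows "P \<noteq> 0"
proof
  assume "P = 0"
  obtain k :: nat and x y where k: "1 \<le> k" and fam: "symplectic_family {1..k} x y"
    and P: "P = family_projection {1..k} x y"
    using assms unfolding symplectic_projection_def symplectically_orthonormal_iff
      symplectic_projection_of_eq by blast
  have "P *v x 1 = J *v y 1"
    using k family_projection_basis [OF fam, of "{1..k}" 1] by (simp add: P)
  moreover have "x 1 \<bullet> (J *v y 1) = 1"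
    using k symplectic_familyD [OF fam] by simp
  ultimately show False using \<open>P = 0\<close> by simp
qed

subsection \<open>The spectral decomposition\<close>

lemma exists_symplectic_spectral_decomposition:
  fixes B :: "real^('n::finite + 'n)^('n + 'n)"
  assumes "positive_definite B"
  shows "\<exists>m \<mu> P. symplectic_spectral_decomposition B m \<mu> P"
proof -
  obtain u v :: "'n \<Rightarrow> real^('n + 'n)" and d
    where fam: "symplectic_family UNIV u v" and d: "\<And>i. 0 < d i"
      and pair: "\<And>i. symplectic_eigenvector_pair B (d i) (u i) (v i)"
    using exists_symplectic_family_of_eigenvector_pairs [OF assms, of UNIV] by auto
  \<comment> \<open>\<open>m\<close> counts the distinct eigenvalues and \<mu> enumerates them, each
    once.\<close>
  define m where "m = card (range d)"
  obtain \<mu> where \<mu>: "bij_betw \<mu> {1..m} (range d)"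
    using ex_bij_betw_nat_finite_1 [of "range d"] by (auto simp: m_def)
  have \<mu>_range: "\<mu> k \<in> range d" if "k \<in> {1..m}" for k
    using bij_betwE [OF \<mu>] that by blast
  have pos: "0 < \<mu> k" if "k \<in> {1..m}" for k
    using \<mu>_range [OF that] d by auto
  have inj: "inj_on \<mu> {1..m}"
    using \<mu> by (rule bij_betw_imp_inj_on)
  define P where "P k = family_projection {i. d i = \<mu> k} u v" for k
  have Pu: "P k *v u a = (if d a = \<mu> k then J *v v a else 0)"
    and Pv: "P k *v v a = (if d a = \<mu> k then - (J *v u a) else 0)" for k a
    using family_projection_basis [OF fam, of "{i. d i = \<mu> k}" a] by (simp_all add: P_def)
  \<comment> \<open>Exactly one \<open>k\<close> in the range has \<open>\<mu> k = d a\<close>, so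
    the sum has a single surviving term.\<close>
  have pick: "(\<Sum>k=1..m. if d a = \<mu> k then f k else 0) = c"
    if "\<And>k. d a = \<mu> k \<Longrightarrow> f k = c" for a and f :: "nat \<Rightarrow> real^('n + 'n)" and c
  proof -
    obtain l where l: "l \<in> {1..m}" "\<mu> l = d a"
      using \<mu> unfolding bij_betw_def by (metis imageE rangeI)
    have "(\<Sum>k=1..m. if d a = \<mu> k then f k else 0) = (\<Sum>k=1..m. if l = k then f k else 0)"
      using l inj_on_eq_iff [OF inj] by (intro sum.cong) auto
    then show ?thesis using l that by simp
  qed
  \<comment> \<open>On the basis, the product agrees with \<open>J\<close> on the eigenspace shared
    by both projections and vanishes elsewhere; this yields (i) and (ii).\<close>
  have PJP: "(P j ** J ** P k) *v u a = (if d a = \<mu> k \<and> \<mu> j = \<mu> k then J *v u a else 0)"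
    "(P j ** J ** P k) *v v a = (if d a = \<mu> k \<and> \<mu> j = \<mu> k then J *v v a else 0)" for j k a
    by (auto simp: matrix_vector_mul_assoc [symmetric] Pu Pv J_J_vec matrix_vector_mult_minus_right)
  have "symplectic_projection (P k)" if "k \<in> {1..m}" for k
    unfolding P_def using \<mu>_range [OF that] by (intro symplectic_projection_family [OF fam]) auto
  moreover have "P j ** J ** P k = 0" if "j \<in> {1..m}" "k \<in> {1..m}" "j \<noteq> k" for j k
    using inj_on_eq_iff [OF inj] that
    by (intro symplectic_basis_matrix_ext [OF fam]) (simp_all add: PJP)
  moreover have "(\<Sum>k=1..m. P k ** J ** P k) = J"
    by (intro symplectic_basis_matrix_ext [OF fam])
      (simp_all add: sum_matrix_vector_mult PJP pick del: One_nat_def)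
  moreover have "B = (\<Sum>k=1..m. \<mu> k *\<^sub>R P k)"
  proof (rule symplectic_basis_matrix_ext [OF fam])
    fix a
    have "(\<Sum>k=1..m. \<mu> k *\<^sub>R P k) *v u a = (\<Sum>k=1..m. if d a = \<mu> k then \<mu> k *\<^sub>R (J *v v a) else 0)"
      by (simp add: sum_matrix_vector_mult scaleR_matrix_vector_assoc [symmetric] Pu if_distrib
          cong: if_cong)
    also have "\<dots> = d a *\<^sub>R (J *v v a)" by (rule pick) simp
    finally show "B *v u a = (\<Sum>k=1..m. \<mu> k *\<^sub>R P k) *v u a"
      using pair by (simp add: symplectic_eigenvector_pair_def)
    have "(\<Sum>k=1..m. \<mu> k *\<^sub>R P k) *v v a = (\<Sum>k=1..m. if d a = \<mu> k then - \<mu> k *\<^sub>R (J *v u a) else 0)"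
      by (simp add: sum_matrix_vector_mult scaleR_matrix_vector_assoc [symmetric] Pv if_distrib
          cong: if_cong)
    also have "\<dots> = - d a *\<^sub>R (J *v u a)" by (rule pick) simp
    finally show "B *v v a = (\<Sum>k=1..m. \<mu> k *\<^sub>R P k) *v v a"
      using pair by (simp add: symplectic_eigenvector_pair_def)
  qed
  ultimately have "symplectic_spectral_decomposition B m \<mu> P"
    unfolding symplectic_spectral_decomposition_def using inj pos by blast
  then show ?thesis by blast
qed

section \<open>Uniqueness, and the eigenvector pairs behind a decomposition\<close>

lemma symplectic_spectral_decompositionD:
  assumes "symplectic_spectral_decomposition B m \<mu> P"
  shows "inj_on \<mu> {1..m}"
    and "k \<in> {1..m} \<Longrightarrow> 0 < \<mu> k"
    and "k \<in> {1..m} \<Longrightarrow> symplectic_projection (P k)"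
    and "j \<in> {1..m} \<Longrightarrow> k \<in> {1..m} \<Longrightarrow> j \<noteq> k \<Longrightarrow> P j ** J ** P k = 0"
    and "(\<Sum>k=1..m. P k ** J ** P k) = J"
    and "B = (\<Sum>k=1..m. \<mu> k *\<^sub>R P k)"
  using assms unfolding symplectic_spectral_decomposition_def by blast+

lemma sum_eq_single:
  fixes f :: "'i \<Rightarrow> 'a::comm_monoid_add"
  assumes "finite I" "j \<in> I" "\<And>k. k \<in> I \<Longrightarrow> k \<noteq> j \<Longrightarrow> f k = 0"
  shows "sum f I = f j"
  using assms by (simp add: sum.remove [of I j])

lemma scaleR_matrix_mult_left: "(c *\<^sub>R A) ** C = c *\<^sub>R (A ** C)"
  and scaleR_matrix_mult_right: "A ** (c *\<^sub>R C) = c *\<^sub>R (A ** C)"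
  for A :: "real^'b^'a" and C :: "real^'c^'b"
  by (simp_all add: matrix_matrix_mult_def vec_eq_iff sum_distrib_left algebra_simps)

text \<open>Condition (i) kills every term of the expansion of \<open>B\<close> except the one with
  index \<open>j\<close>.\<close>

lemma spectral_projection_mult:
  assumes dec: "symplectic_spectral_decomposition B m \<mu> P" and j: "j \<in> {1..m}"
  shows "P j ** J ** B = \<mu> j *\<^sub>R (P j ** J ** P j)"
    and "B ** J ** P j = \<mu> j *\<^sub>R (P j ** J ** P j)"
proof -
  note D = symplectic_spectral_decompositionD [OF dec]
  have "P j ** J ** B = (\<Sum>k=1..m. \<mu> k *\<^sub>R (P j ** J ** P k))"
    by (subst D(6)) (simp add: sum_matrix_mult_left scaleR_matrix_mult_right)
  also have "\<dots> = \<mu> j *\<^sub>R (P j ** J ** P j)"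
    using j D(4) by (intro sum_eq_single) auto
  finally show "P j ** J ** B = \<mu> j *\<^sub>R (P j ** J ** P j)" .
  have "B ** J ** P j = (\<Sum>k=1..m. \<mu> k *\<^sub>R (P k ** J ** P j))"
    by (subst D(6)) (simp add: sum_matrix_mult_right scaleR_matrix_mult_left)
  also have "\<dots> = \<mu> j *\<^sub>R (P j ** J ** P j)"
    using j D(4) by (intro sum_eq_single) auto
  finally show "B ** J ** P j = \<mu> j *\<^sub>R (P j ** J ** P j)" .
qed

text \<open>
  For two decompositions \<open>P j ** J ** B ** J ** B = - (\<mu> j)\<^sup>2 P j\<close> and
  \<open>B ** J ** B ** J ** P' k = - (\<mu>' k)\<^sup>2 P' k\<close>; hence \<open>P j ** J ** P' k = 0\<close> unless \<open>\<mu> j = \<mu>' k\<close>.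
\<close>

lemma spectral_decompositions_match:
  assumes dec: "symplectic_spectral_decomposition B m \<mu> P"
    and dec': "symplectic_spectral_decomposition B m' \<mu>' P'"
    and j: "j \<in> {1..m}"
  shows "\<exists>k\<in>{1..m'}. \<mu>' k = \<mu> j \<and> P' k = P j"
proof -
  note D = symplectic_spectral_decompositionD [OF dec]
  note D' = symplectic_spectral_decompositionD [OF dec']
  note M = spectral_projection_mult [OF dec] and M' = spectral_projection_mult [OF dec']
  have orth: "P i ** J ** P' k = 0" if "i \<in> {1..m}" "k \<in> {1..m'}" "\<mu> i \<noteq> \<mu>' k" for i k
  proof -
    have "P i ** J ** B ** J ** B = - ((\<mu> i)\<^sup>2 *\<^sub>R P i)"
    proof -
      have "P i ** J ** B ** J ** B = (\<mu> i *\<^sub>R (P i ** J ** P i)) ** J ** B"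
        by (simp only: M(1) [OF that(1)])
      also have "\<dots> = \<mu> i *\<^sub>R (P i ** J ** (P i ** J ** B))"
        by (simp add: scaleR_matrix_mult_left matrix_mul_assoc)
      also have "\<dots> = \<mu> i *\<^sub>R (P i ** J ** (\<mu> i *\<^sub>R (P i ** J ** P i)))"
        by (simp only: M(1) [OF that(1)])
      also have "\<dots> = (\<mu> i)\<^sup>2 *\<^sub>R (P i ** J ** P i ** J ** P i)"
        by (simp add: scaleR_matrix_mult_right matrix_mul_assoc power2_eq_square)
      finally show ?thesis using symplectic_projection_cube [OF D(3)] that by simp
    qed
    moreover have "B ** J ** B ** J ** P' k = - ((\<mu>' k)\<^sup>2 *\<^sub>R P' k)"
    proof -
      have "B ** J ** B ** J ** P' k = B ** J ** (B ** J ** P' k)"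
        by (simp add: matrix_mul_assoc)
      also have "\<dots> = B ** J ** (\<mu>' k *\<^sub>R (P' k ** J ** P' k))"
        by (simp only: M'(2) [OF that(2)])
      also have "\<dots> = \<mu>' k *\<^sub>R (B ** J ** P' k ** J ** P' k)"
        by (simp add: scaleR_matrix_mult_right matrix_mul_assoc)
      also have "\<dots> = (\<mu>' k)\<^sup>2 *\<^sub>R (P' k ** J ** P' k ** J ** P' k)"
        by (simp add: M' [OF that(2)] scaleR_matrix_mult_left power2_eq_square)
      finally show ?thesis using symplectic_projection_cube [OF D'(3)] that by simp
    qed
    moreover have "(P i ** J ** B ** J ** B) ** J ** P' k = P i ** J ** (B ** J ** B ** J ** P' k)"
      by (simp add: matrix_mul_assoc)
    ultimately have "(\<mu> i)\<^sup>2 *\<^sub>R (P i ** J ** P' k) = (\<mu>' k)\<^sup>2 *\<^sub>R (P i ** J ** P' k)"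
      by (simp add: matrix_mult_minus_left matrix_mult_minus_right scaleR_matrix_mult_left
          scaleR_matrix_mult_right)
    \<comment> \<open>Positivity of the eigenvalues is what makes their squares differ.\<close>
    moreover have "(\<mu> i)\<^sup>2 \<noteq> (\<mu>' k)\<^sup>2"
      using D(2) [of i] D'(2) [of k] that by (simp add: power2_eq_iff)
    ultimately show ?thesis by simp
  qed
  \<comment> \<open>Condition (ii) of the second decomposition is inserted into
    \<open>P j = - (P j ** J ** J)\<close>.\<close>
  have expand: "P j = - (\<Sum>k=1..m'. P j ** J ** P' k ** J ** P' k)"
  proof -
    have "P j = - (P j ** J ** J)"
      by (simp add: matrix_mul_assoc [symmetric] J_mult_J matrix_mult_minus_right)
    also have "P j ** J ** J = P j ** J ** (\<Sum>k=1..m'. P' k ** J ** P' k)"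
      by (simp only: D'(5))
    finally show ?thesis by (simp add: sum_matrix_mult_left matrix_mul_assoc)
  qed
  have "\<exists>k\<in>{1..m'}. \<mu>' k = \<mu> j"
  proof (rule ccontr)
    assume "\<not> ?thesis"
    then have "P j ** J ** P' k = 0" if "k \<in> {1..m'}" for k
      using orth j that by metis
    then have "P j = 0" using expand by simp
    then show False using symplectic_projection_nonzero [OF D(3) [OF j]] by simp
  qed
  then obtain k where k: "k \<in> {1..m'}" "\<mu>' k = \<mu> j" by blast
  have orth_j: "P j ** J ** P' l = 0" if "l \<in> {1..m'}" "l \<noteq> k" for l
    using orth [OF j] that k inj_onD [OF D'(1)] by metis
  have orth_k: "P i ** J ** P' k = 0" if "i \<in> {1..m}" "i \<noteq> j" for i
    using orth [of i k] that j k inj_onD [OF D(1)] by metis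
  \<comment> \<open>\<open>B ** J ** P' k\<close> is computed from both decompositions; one term
    survives in each, and the common eigenvalue cancels.\<close>
  have "\<mu> j *\<^sub>R (P j ** J ** P' k) = (\<Sum>i=1..m. \<mu> i *\<^sub>R (P i ** J ** P' k))"
    using orth_k j by (intro sum_eq_single [symmetric]) auto
  also have "\<dots> = B ** J ** P' k"
    by (subst D(6)) (simp add: sum_matrix_mult_right scaleR_matrix_mult_left)
  also have "\<dots> = \<mu> j *\<^sub>R (P' k ** J ** P' k)"
    using M'(2) [OF k(1)] k by simp
  finally have PJP': "P j ** J ** P' k = P' k ** J ** P' k"
    using D(2) [OF j] by simp
  \<comment> \<open>Only index \<open>k\<close> survives in \<open>expand\<close>; replacing
    \<open>P j\<close> by \<open>P' k\<close> there leaves the cube identity for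
    \<open>P' k\<close>.\<close>
  have "P j = - (P j ** J ** P' k ** J ** P' k)"
    by (subst expand, subst sum_eq_single [of _ k]) (use k orth_j in auto)
  also have "\<dots> = - (P' k ** J ** P' k ** J ** P' k)"
    by (simp add: PJP')
  also have "\<dots> = P' k"
    using symplectic_projection_cube [OF D'(3) [OF k(1)]] by simp
  finally show ?thesis using k by auto
qed

text \<open>Matching in both directions equates the two sets of eigenvalues, hence
  \<open>m = m'\<close>. The matching map is injective because \<mu> is, and an injective self-map
  of a finite set is bijective.\<close>

lemma spectral_decomposition_unique:
  assumes dec: "symplectic_spectral_decomposition B m \<mu> P"
    and dec': "symplectic_spectral_decomposition B m' \<mu>' P'"
  shows "m = m' \<and> (\<exists>\<sigma>. bij_betw \<sigma> {1..m} {1..m} \<and>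
    (\<forall>k\<in>{1..m}. \<mu>' (\<sigma> k) = \<mu> k \<and> P' (\<sigma> k) = P k))"
proof -
  note inj = symplectic_spectral_decompositionD(1) [OF dec]
    and inj' = symplectic_spectral_decompositionD(1) [OF dec']
  obtain \<sigma> where \<sigma>: "\<sigma> k \<in> {1..m'}" "\<mu>' (\<sigma> k) = \<mu> k" "P' (\<sigma> k) = P k" if "k \<in> {1..m}" for k
    using spectral_decompositions_match [OF dec dec'] by metis
  have "\<mu> ` {1..m} = \<mu>' ` {1..m'}"
  proof
    show "\<mu> ` {1..m} \<subseteq> \<mu>' ` {1..m'}"
      using \<sigma> by (metis image_eqI image_subsetI)
    show "\<mu>' ` {1..m'} \<subseteq> \<mu> ` {1..m}"
      using spectral_decompositions_match [OF dec' dec] by (metis image_eqI image_subsetI)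
  qed
  then have "m = m'"
    using card_image [OF inj] card_image [OF inj'] by simp
  moreover have "inj_on \<sigma> {1..m}"
    using \<sigma>(2) inj by (metis inj_on_def)
  then have "bij_betw \<sigma> {1..m} {1..m}"
    using \<sigma>(1) \<open>m = m'\<close> by (intro bij_betw_imageI endo_inj_surj) auto
  ultimately show ?thesis using \<sigma> by blast
qed

text \<open>Both \<open>x i\<close> and \<open>y i\<close> lie in the range of
  \<open>J ** P j\<close>, so condition (i) makes every other projection kill them and
  \<open>B\<close> acts on them as \<open>\<mu> j *\<^sub>R P j\<close>.\<close>

lemma spectral_projection_eigenvector_pairs:
  assumes dec: "symplectic_spectral_decomposition B m \<mu> P" and j: "j \<in> {1..m}"
    and orth: "symplectically_orthonormal k x y" and P: "P j = symplectic_projection_of k x y"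
    and i: "i \<in> {1..k}"
  shows "symplectic_eigenvector_pair B (\<mu> j) (x i) (y i)"
proof -
  note D = symplectic_spectral_decompositionD [OF dec]
  have fam: "symplectic_family {1..k} x y"
    using orth by (simp add: symplectically_orthonormal_iff)
  have Px: "P j *v x i = J *v y i" and Py: "P j *v y i = - (J *v x i)"
    using family_projection_basis [OF fam subset_refl finite_atLeastAtMost i] i
    by (simp_all add: P symplectic_projection_of_eq)
  have x: "x i = (J ** P j) *v y i" and y: "y i = - ((J ** P j) *v x i)"
    by (simp_all add: matrix_vector_mul_assoc [symmetric] Px Py J_J_vec
        matrix_vector_mult_minus_right)
  have B: "B *v z = \<mu> j *\<^sub>R (P j *v z)"
    if "\<And>l. l \<in> {1..m} \<Longrightarrow> l \<noteq> j \<Longrightarrow> P l *v z = 0" for z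
  proof -
    have "B *v z = (\<Sum>l=1..m. \<mu> l *\<^sub>R (P l *v z))"
      by (subst D(6)) (simp add: sum_matrix_vector_mult scaleR_matrix_vector_assoc)
    also have "\<dots> = \<mu> j *\<^sub>R (P j *v z)"
      using j that by (intro sum_eq_single) auto
    finally show ?thesis .
  qed
  have zero: "P l *v ((J ** P j) *v z) = 0" if "l \<in> {1..m}" "l \<noteq> j" for l z
    using D(4) [OF that(1) j that(2)] by (simp add: matrix_vector_mul_assoc matrix_mul_assoc)
  have "P l *v x i = 0" "P l *v y i = 0" if "l \<in> {1..m}" "l \<noteq> j" for l
    using zero [OF that, of "y i"] zero [OF that, of "x i"] x y
    by (metis, metis matrix_vector_mult_minus_right neg_equal_0_iff_equal)
  then show ?thesis
    using B [of "x i"] B [of "y i"] by (simp add: symplectic_eigenvector_pair_def Px Py)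
qed

theorem proposition5p2:
  fixes B :: "real^('n::{finite,linorder} + 'n)^('n + 'n)"
  assumes "positive_definite B"
  shows "(\<exists>m \<mu> P. symplectic_spectral_decomposition B m \<mu> P) \<and>
    (\<forall>m \<mu> P m' \<mu>' P'.
       symplectic_spectral_decomposition B m \<mu> P \<and>
       symplectic_spectral_decomposition B m' \<mu>' P' \<longrightarrow>
       m = m' \<and>
       (\<exists>\<sigma>. bij_betw \<sigma> {1..m} {1..m} \<and>
          (\<forall>k\<in>{1..m}. \<mu>' (\<sigma> k) = \<mu> k \<and> P' (\<sigma> k) = P k))) \<and>
    (\<forall>m \<mu> P. symplectic_spectral_decomposition B m \<mu> P \<longrightarrow>
       (\<forall>j\<in>{1..m}.
          symplectic_eigenvalue B (\<mu> j) \<and>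
          (\<exists>k x y. symplectically_orthonormal k x y \<and>
             (\<forall>i\<in>{1..k}. symplectic_eigenvector_pair B (\<mu> j) (x i) (y i)) \<and>
             P j = symplectic_projection_of k x y)))"
proof (intro conjI)
  show "\<exists>m \<mu> P. symplectic_spectral_decomposition B m \<mu> P"
    using assms by (rule exists_symplectic_spectral_decomposition)
  show "\<forall>m \<mu> P m' \<mu>' P'.
       symplectic_spectral_decomposition B m \<mu> P \<and>
       symplectic_spectral_decomposition B m' \<mu>' P' \<longrightarrow>
       m = m' \<and>
       (\<exists>\<sigma>. bij_betw \<sigma> {1..m} {1..m} \<and>
          (\<forall>k\<in>{1..m}. \<mu>' (\<sigma> k) = \<mu> k \<and> P' (\<sigma> k) = P k))"
    using spectral_decomposition_unique by (intro allI impI) blast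
  show "\<forall>m \<mu> P. symplectic_spectral_decomposition B m \<mu> P \<longrightarrow>
       (\<forall>j\<in>{1..m}.
          symplectic_eigenvalue B (\<mu> j) \<and>
          (\<exists>k x y. symplectically_orthonormal k x y \<and>
             (\<forall>i\<in>{1..k}. symplectic_eigenvector_pair B (\<mu> j) (x i) (y i)) \<and>
             P j = symplectic_projection_of k x y))"
  proof (intro allI impI ballI)
    fix m \<mu> P j
    assume dec: "symplectic_spectral_decomposition B m \<mu> P" and j: "j \<in> {1..m}"
    note D = symplectic_spectral_decompositionD [OF dec]
    \<comment> \<open>Any representation of \<open>P j\<close> serves as witness, since its vectors
      are automatically eigenvector pairs for \<open>\<mu> j\<close>.\<close>
    obtain k x y where orth: "symplectically_orthonormal k x y"
      and P: "P j = symplectic_projection_of k x y"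
      using D(3) [OF j] unfolding symplectic_projection_def by blast
    have pairs: "\<forall>i\<in>{1..k}. symplectic_eigenvector_pair B (\<mu> j) (x i) (y i)"
      using spectral_projection_eigenvector_pairs [OF dec j orth P] by blast
    \<comment> \<open>The first pair exists as \<open>k\<close> is positive, and its product 1 makes
      \<open>x 1\<close> nonzero, so \<open>\<mu> j\<close> occurs in the Williamson form.\<close>
    have "1 \<in> {1..k}" "x 1 \<bullet> (J *v y 1) = 1"
      using orth by (simp_all add: symplectically_orthonormal_def)
    then have "x 1 \<noteq> 0" "symplectic_eigenvector_pair B (\<mu> j) (x 1) (y 1)"
      using pairs by (auto simp del: atLeastAtMost_iff)
    then have "symplectic_eigenvalue B (\<mu> j)"
      using symplectic_eigenvalue_of_pair [OF assms D(2) [OF j]] by blast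
    with orth pairs P show "symplectic_eigenvalue B (\<mu> j) \<and>
          (\<exists>k x y. symplectically_orthonormal k x y \<and>
             (\<forall>i\<in>{1..k}. symplectic_eigenvector_pair B (\<mu> j) (x i) (y i)) \<and>
             P j = symplectic_projection_of k x y)"
      by blast
  qed
qed

end
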